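(* Let $k\ge 0$ be an integer, let $q\ge 1$ be real, and let $B,B'$ be $k$-strict barcodes with $n$ bars such that $g_k(B)=g_k(B')$. Write $B=\{(b_i,d_i)\}_{i=1}^n$, and suppose there exists a bar $(b_*,d_* )\in B$ which contains all others, i.e. $b_*\le b_i$ and $d_*\ge d_i$ for all $i\in[n]$ (equivalently, such a bar exists in $B'$). Then there exist constants $\alpha>0$ and $\delta\in\mathbb{R}$ such that $$d_\infty(B,\alpha B'+\delta)\le\frac{|d_*-b_*|}{2^k}\quad\text{and}\quad d_q(B,\alpha B'+\delta)\le (n-1)^{\frac1q}\,\frac{|d_*-b_*|}{2^k}.$$
   Context: $[n]=\{1,\ldots,n\}$. A barcode with $n$ bars is a finite multiset of intervals on the real line $B=\{(b_i,d_i)\}_{i=1}^n$ with $b_i<d_i$ for all $i\in[n]$; the indexing by $[n]$ is a choice of labeling. $B$ is $k$-strict if the sets $\{b_i+\ell\frac{d_i-b_i}{2^k}:\ell=0,\ldots,2^k\}$ and $\{b_j+\ell\frac{d_j-b_j}{2^k}:\ell=0,\ldots,2^k\}$ are disjoint for all $i\ne j$. For $B'=\{(b_i',d_i')\}_{i=1}^n$, $\alpha>0$, $\delta\in\mathbb R$, $\alpha B'+\delta:=\{(\alpha b_i'+\delta,\alpha d_i'+\delta):i\in[n]\}$. $L((2^k+1)^n)$ is the set of all permutations (words) of the multiset in which each of $1,\ldots,n$ has multiplicity $2^k+1$. For a $k$-strict barcode $B$, the $n(2^k+1)$ points $b_i+\ell\frac{d_i-b_i}{2^k}$ ($i\in[n]$,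 $0\le\ell\le 2^k$) are distinct; list them in increasing order and let $f_k(B)\in L((2^k+1)^n)$ be the word whose $r$-th letter is the index $i$ of the bar from which the $r$-th smallest point comes. $\mathfrak{S}_n$ acts on $L((2^k+1)^n)$ by applying a permutation to every letter, and $g_k(B)=[f_k(B)]\in L((2^k+1)^n)/\mathfrak{S}_n$ is the orbit of $f_k(B)$; it does not depend on the labeling of the bars. Distances. View bars as points $(b,d)\in\mathbb{R}^2$ and let $\Delta=\{(x,x):x\in\mathbb{R}\}$. A perfect matching $\gamma$ between barcodes $B$ and $B'$ pairs each bar of $B$ either with a bar of $B'$ or with a point of $\Delta$, and each bar of $B'$ either with a bar of $B$ or with a point of $\Delta$, every bar (counted with multiplicity) being used in exactly one pair. The bottleneck distance is $d_\infty(B,B')=\inf_\gamma\max\|x-y\|_\infty$, the maximum being over matched pairs $(x,y)$ of $\gamma$, and the $q$-Wasserstein distance is $d_q(B,B')=\inf_\gamma\big(\sum\|x-y\|_\infty^q\big)^{1/q}$, the sum being over matched pairs; here $\|\cdot\|_\infty$ is the $\ell^\infty$-norm on $\mathbb{R}^2$. *)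

theory Defs
  imports "HOL-Analysis.Analysis" "HOL-Combinatorics.Multiset_Permutations"
begin

section \<open>Barcodes\<close>

type_synonym bar = "real \<times> real"

definition barcode :: "bar multiset \<Rightarrow> bool" where
  "barcode B \<longleftrightarrow> (\<forall>(b, d) \<in># B. b < d)"

definition labeling :: "bar multiset \<Rightarrow> (nat \<Rightarrow> bar) \<Rightarrow> bool" where
  "labeling B v \<longleftrightarrow> image_mset v (mset_set {1..size B}) = B"

definition grid_point :: "nat \<Rightarrow> bar \<Rightarrow> nat \<Rightarrow> real" where
  "grid_point k x l = fst x + real l * ((snd x - fst x) / 2 ^ k)"

text \<open>By \<open>k_strict_labeling\<close> below, the choice of labeling is immaterial.\<close>

definition k_strict :: "nat \<Rightarrow> bar multiset \<Rightarrow> bool" where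
  "k_strict k B \<longleftrightarrow> (\<exists>v. labeling B v \<and>
     (\<forall>i\<in>{1..size B}. \<forall>j\<in>{1..size B}. i \<noteq> j \<longrightarrow>
        grid_point k (v i) ` {0..2 ^ k} \<inter> grid_point k (v j) ` {0..2 ^ k} = {}))"

definition rescale :: "real \<Rightarrow> real \<Rightarrow> bar multiset \<Rightarrow> bar multiset" where
  "rescale \<alpha> \<delta> B = image_mset (\<lambda>(b, d). (\<alpha> * b + \<delta>, \<alpha> * d + \<delta>)) B"

definition contains_all :: "bar \<Rightarrow> bar multiset \<Rightarrow> bool" where
  "contains_all x B \<longleftrightarrow> x \<in># B \<and> (\<forall>y \<in># B. fst x \<le> fst y \<and> snd y \<le> snd x)"

section \<open>Multipermutations of barcodes\<close>

definition multiperms :: "nat \<Rightarrow> nat \<Rightarrow> nat list set" where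
  "multiperms m n = permutations_of_multiset (\<Sum>i\<in>{1..n}. replicate_mset m i)"

definition relabel_rel :: "nat \<Rightarrow> nat \<Rightarrow> (nat list \<times> nat list) set" where
  "relabel_rel m n =
     {(w, w'). w \<in> multiperms m n \<and> (\<exists>\<sigma>. \<sigma> permutes {1..n} \<and> w' = map \<sigma> w)}"

definition bar_word :: "nat \<Rightarrow> nat \<Rightarrow> (nat \<Rightarrow> bar) \<Rightarrow> nat list" where
  "bar_word k n v = map fst (sort_key (\<lambda>(i, l). grid_point k (v i) l)
     (List.product [1..<Suc n] [0..<Suc (2 ^ k)]))"

text \<open>The orbit of the word under relabeling, as an element of the quotient
  \<open>multiperms (2 ^ k + 1) n // relabel_rel (2 ^ k + 1) n\<close>. For a \<open>k\<close>-strict barcode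
  every labeling gives the same orbit, see \<open>word_class_eq\<close>.\<close>

definition word_class :: "nat \<Rightarrow> bar multiset \<Rightarrow> nat list set" where
  "word_class k B = relabel_rel (2 ^ k + 1) (size B) ``
     {bar_word k (size B) (SOME v. labeling B v)}"

section \<open>Distances\<close>

definition diagonal :: "bar set" where
  "diagonal = {(x, x) | x. True}"

text \<open>\<open>M\<close> pairs bars with bars, \<open>L\<close> bars of \<open>B\<close> with diagonal points, and \<open>R\<close> diagonal
  points with bars of \<open>B'\<close>.\<close>

definition perfect_matching :: "bar multiset \<Rightarrow> bar multiset \<Rightarrow> (bar \<times> bar) multiset \<Rightarrow> bool" where
  "perfect_matching B B' \<gamma> \<longleftrightarrow> (\<exists>M L R. \<gamma> = M + L + R \<and>
     image_mset fst (M + L) = B \<and> image_mset snd (M + R) = B' \<and>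
     (\<forall>p \<in># L. snd p \<in> diagonal) \<and> (\<forall>p \<in># R. fst p \<in> diagonal))"

text \<open>\<open>infnorm\<close> is the maximum norm on the plane, see \<open>infnorm_pair\<close>. Inserting \<open>0\<close> only
  matters for the empty matching, as \<open>infnorm\<close> is nonnegative.\<close>

definition bottleneck_dist :: "bar multiset \<Rightarrow> bar multiset \<Rightarrow> real" where
  "bottleneck_dist B B' =
     (INF \<gamma>\<in>{\<gamma>. perfect_matching B B' \<gamma>}. Max (insert 0 ((\<lambda>(x, y). infnorm (x - y)) ` set_mset \<gamma>)))"

definition wasserstein_dist :: "real \<Rightarrow> bar multiset \<Rightarrow> bar multiset \<Rightarrow> real" where
  "wasserstein_dist q B B' =
     (INF \<gamma>\<in>{\<gamma>. perfect_matching B B' \<gamma>}. (\<Sum>(x, y)\<in>#\<gamma>. infnorm (x - y) powr q) powr (1 / q))"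

section \<open>Independence of the choices, and well-definedness\<close>

lemma infnorm_pair: "infnorm ((x, y) :: real \<times> real) = max \<bar>x\<bar> \<bar>y\<bar>"
proof -
  have B: "(Basis :: (real \<times> real) set) = {(1, 0), (0, 1)}"
    by (auto simp: Basis_prod_def)
  show ?thesis
    unfolding infnorm_Max B by (simp add: inner_prod_def)
qed

lemma labeling_exists: "\<exists>v. labeling B v"
proof -
  obtain xs where xs: "mset xs = B" by (metis ex_mset)
  have "image_mset (\<lambda>i. xs ! (i - 1)) (mset_set {1..length xs})
      = image_mset ((!) xs) (mset_set {0..<length xs})"
  proof -
    have "mset_set {1..length xs} = image_mset Suc (mset_set {0..<length xs})"
      by (subst image_mset_mset_set) (auto simp: image_Suc_atLeastLessThan atLeastLessThanSuc_atLeastAtMost)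
    then show ?thesis by (simp add: image_mset.compositionality comp_def)
  qed
  also have "\<dots> = mset xs"
    by (metis map_nth mset_map mset_upt)
  finally show ?thesis using xs by (auto simp: labeling_def)
qed

lemma labelings_permuted:
  assumes "labeling B v" "labeling B w"
  obtains p where "p permutes {1..size B}" "\<forall>i\<in>{1..size B}. v i = w (p i)"
  using image_mset_eq_implies_permutes[of "{1..size B}" v w] assms
  unfolding labeling_def by (metis finite_atLeastAtMost)

lemma k_strict_labeling:
  assumes "k_strict k B" "labeling B v" "i \<in> {1..size B}" "j \<in> {1..size B}" "i \<noteq> j"
  shows "grid_point k (v i) ` {0..2 ^ k} \<inter> grid_point k (v j) ` {0..2 ^ k} = {}"
proof -
  obtain w where w: "labeling B w"
    "\<And>i j. i\<in>{1..size B} \<Longrightarrow> j\<in>{1..size B} \<Longrightarrow> i \<noteq> j \<Longrightarrow>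
        grid_point k (w i) ` {0..2 ^ k} \<inter> grid_point k (w j) ` {0..2 ^ k} = {}"
    using assms(1) unfolding k_strict_def by blast
  obtain p where p: "p permutes {1..size B}" "\<forall>i\<in>{1..size B}. v i = w (p i)"
    using labelings_permuted[OF assms(2) w(1)] .
  have "p i \<in> {1..size B}" "p j \<in> {1..size B}" "p i \<noteq> p j"
    using p(1) assms(3-5) permutes_in_image[OF p(1)] permutes_inj[OF p(1)] by (auto dest: injD)
  with w(2) p(2) assms(3,4) show ?thesis by simp
qed

lemma bar_word_in_multiperms: "bar_word k n v \<in> multiperms (2 ^ k + 1) n"
proof -
  have 1: "mset (map fst (List.product xs ys)) = (\<Sum>i\<leftarrow>xs. replicate_mset (length ys) i)"
    for xs :: "nat list" and ys :: "nat list"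
    by (induction xs) (auto simp: comp_def map_replicate_const)
  have "mset (bar_word k n v) = (\<Sum>i\<leftarrow>[1..<Suc n]. replicate_mset (2 ^ k + 1) i)"
    using 1[of "[1..<Suc n]" "[0..<Suc (2 ^ k)]"] unfolding bar_word_def by simp
  also have "\<dots> = (\<Sum>i\<in>{1..n}. replicate_mset (2 ^ k + 1) i)"
    by (subst sum_list_distinct_conv_sum_set)
       (auto simp del: upt_Suc simp: atLeastLessThanSuc_atLeastAtMost)
  finally show ?thesis unfolding multiperms_def by (rule permutations_of_multisetI)
qed

lemma map_multiperms:
  assumes "w \<in> multiperms m n" "\<sigma> permutes {1..n}"
  shows "map \<sigma> w \<in> multiperms m n"
proof -
  have "mset (map \<sigma> w) = (\<Sum>i\<in>{1..n}. replicate_mset m (\<sigma> i))"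
  proof -
    have "image_mset \<sigma> (\<Sum>i\<in>A. replicate_mset m i) = (\<Sum>i\<in>A. replicate_mset m (\<sigma> i))" for A
      by (induction A rule: infinite_finite_induct) auto
    then show ?thesis using assms(1) by (simp add: multiperms_def permutations_of_multiset_def)
  qed
  also have "\<dots> = (\<Sum>i\<in>{1..n}. replicate_mset m i)"
    using sum.permute[OF assms(2), of "replicate_mset m"] by (simp add: comp_def)
  finally show ?thesis by (simp add: multiperms_def permutations_of_multisetI)
qed

lemma equiv_relabel_rel: "equiv (multiperms m n) (relabel_rel m n)"
proof (rule equivI)
  show "relabel_rel m n \<subseteq> multiperms m n \<times> multiperms m n"
    by (auto simp: relabel_rel_def map_multiperms)
  show "refl_on (multiperms m n) (relabel_rel m n)"
    unfolding refl_on_def relabel_rel_def by (auto intro!: exI[of _ id] permutes_id)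
  show "sym (relabel_rel m n)"
  proof (rule symI)
    fix w w' assume "(w, w') \<in> relabel_rel m n"
    then obtain \<sigma> where s: "w \<in> multiperms m n" "\<sigma> permutes {1..n}" "w' = map \<sigma> w"
      by (auto simp: relabel_rel_def)
    have "w = map (inv \<sigma>) w'"
      using s by (simp add: comp_def permutes_inverses(2)[OF s(2)])
    with s show "(w', w) \<in> relabel_rel m n"
      unfolding relabel_rel_def using map_multiperms permutes_inv by blast
  qed
  show "trans (relabel_rel m n)"
  proof (rule transI)
    fix u v w assume "(u, v) \<in> relabel_rel m n" "(v, w) \<in> relabel_rel m n"
    then show "(u, w) \<in> relabel_rel m n"
      unfolding relabel_rel_def using permutes_compose by fastforce
  qed
qed

lemma grid_point_inj:
  assumes "fst x < snd x" "grid_point k x l = grid_point k x l'"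
  shows "l = l'"
  using assms by (simp add: grid_point_def)

lemma labeling_bar:
  assumes "barcode B" "labeling B v" "i \<in> {1..size B}"
  shows "fst (v i) < snd (v i)"
proof -
  have "v i \<in># image_mset v (mset_set {1..size B})" using assms(3) by simp
  then have "v i \<in># B" using assms(2) by (simp only: labeling_def)
  then show ?thesis using assms(1) by (auto simp: barcode_def)
qed

lemma bar_word_relabel:
  assumes "barcode B" "k_strict k B" "labeling B v" "labeling B w"
  shows "(bar_word k (size B) v, bar_word k (size B) w) \<in> relabel_rel (2 ^ k + 1) (size B)"
proof -
  let ?n = "size B"
  obtain p where p: "p permutes {1..?n}" "\<forall>i\<in>{1..?n}. v i = w (p i)"
    using labelings_permuted[OF assms(3,4)] .
  define P where "P = List.product [1..<Suc ?n] [0..<Suc (2 ^ k)]"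
  define key where "key = (\<lambda>u :: nat \<Rightarrow> bar. \<lambda>(i, l). grid_point k (u i) l)"
  define h where "h = (\<lambda>(i, l :: nat). (p i, l))"
  have setP: "set P = {1..?n} \<times> {0..2 ^ k}"
    by (auto simp: P_def)
  have dP: "distinct P" by (simp add: P_def distinct_product del: upt_Suc)
  have inj_h: "inj h"
    using permutes_inj[OF p(1)] by (auto simp: h_def inj_on_def)
  have img: "h ` set P = set P"
  proof -
    have "h ` ({1..?n} \<times> {0..2 ^ k}) = (p ` {1..?n}) \<times> {0..2 ^ k}"
      unfolding h_def by force
    then show ?thesis using permutes_image[OF p(1)] setP by simp
  qed
  have mset_eq: "mset P = mset (map h (sort_key (key v) P))"
  proof -
    have "mset (map h (sort_key (key v) P)) = mset (map h P)" by simp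
    also have "\<dots> = mset P"
      using dP inj_h img
      by (subst set_eq_iff_mset_eq_distinct[symmetric]) (auto simp: distinct_map intro: inj_on_subset[OF inj_h])
    finally show ?thesis by simp
  qed
  have inj_key: "inj_on (key w) (set P)"
  proof (rule inj_onI)
    fix a b assume ab: "a \<in> set P" "b \<in> set P" "key w a = key w b"
    obtain i l j l' where e: "a = (i, l)" "b = (j, l')" by (metis surj_pair)
    have m: "i \<in> {1..?n}" "j \<in> {1..?n}" "l \<in> {0..2^k}" "l' \<in> {0..2^k}"
      using ab e setP by auto
    have g: "grid_point k (w i) l = grid_point k (w j) l'"
      using ab(3) e by (simp add: key_def)
    have "i = j"
    proof (rule ccontr)
      assume "i \<noteq> j"
      from k_strict_labeling[OF assms(2,4) m(1,2) this] g m(3,4) show False by blast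
    qed
    moreover from this have "l = l'"
      using grid_point_inj[OF labeling_bar[OF assms(1,4) m(1)]] g by simp
    ultimately show "a = b" using e by simp
  qed
  have keys: "key w (h a) = key v a" if "a \<in> set P" for a
    using that p(2) setP by (auto simp: key_def h_def)
  have "map (key w) (map h (sort_key (key v) P)) = map (key v) (sort_key (key v) P)"
    using keys by simp
  then have "sorted (map (key w) (map h (sort_key (key v) P)))"
    by (simp only: sorted_sort_key)
  from sort_key_inj_key_eq[OF mset_eq inj_key this]
  have "sort_key (key w) P = map h (sort_key (key v) P)" .
  then have "bar_word k ?n w = map fst (map h (sort_key (key v) P))"
    unfolding bar_word_def key_def P_def by simp
  also have "\<dots> = map p (map fst (sort_key (key v) P))"
    by (simp add: h_def case_prod_beta)
  finally have "bar_word k ?n w = map p (bar_word k ?n v)"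
    unfolding bar_word_def key_def P_def .
  with p(1) bar_word_in_multiperms show ?thesis by (auto simp: relabel_rel_def)
qed

lemma word_class_eq:
  assumes "barcode B" "k_strict k B" "labeling B v"
  shows "word_class k B = relabel_rel (2 ^ k + 1) (size B) `` {bar_word k (size B) v}"
  unfolding word_class_def
  by (intro equiv_class_eq[OF equiv_relabel_rel] bar_word_relabel[OF assms(1,2)] assms(3)
        someI_ex[OF labeling_exists])

lemma word_class_in_quotient:
  "word_class k B \<in> multiperms (2 ^ k + 1) (size B) // relabel_rel (2 ^ k + 1) (size B)"
  unfolding word_class_def by (intro quotientI bar_word_in_multiperms)

text \<open>The infima are over nonempty sets (of nonnegative numbers), so they are genuine infima.\<close>

lemma perfect_matching_exists: "\<exists>\<gamma>. perfect_matching B B' \<gamma>"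
proof -
  have "perfect_matching B B'
    ({#} + image_mset (\<lambda>x. (x, (0, 0))) B + image_mset (\<lambda>y. ((0, 0), y)) B')"
    unfolding perfect_matching_def diagonal_def
    by (intro exI conjI, rule refl) (auto simp: image_mset.compositionality comp_def)
  then show ?thesis by blast
qed

end

theory Submission
  imports Defs
begin

text \<open>Equal word classes mean that, after relabeling, the grid points of the two barcodes are
  ordered in the same way. Choose the affine map that carries the bar of \<open>B'\<close> corresponding to the
  containing bar onto that bar. Its \<open>2 ^ k + 1\<close> grid points then coincide, and any two
  corresponding endpoints of other bars lie in the same gap between consecutive grid points, so they
  differ by at most the length of a gap. Matching corresponding bars gives both bounds; the
  containing bar contributes nothing.\<close>

section \<open>Lists of labelled points\<close>

text \<open>A list of pairs is determined by its word of first components together with the sequence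
  of second components over each letter. This is how a word, which records only the bars, still
  determines which grid point stands at each position.\<close>

lemma map_prod_eq_by_fibres:
  assumes "map fst ys = map \<sigma> (map fst xs)"
    and "inj_on \<sigma> (fst ` set xs)"
    and "\<And>i. i \<in> fst ` set xs \<Longrightarrow>
      map snd (filter (\<lambda>p. fst p = \<sigma> i) ys) = map snd (filter (\<lambda>p. fst p = i) xs)"
  shows "ys = map (map_prod \<sigma> id) xs"
  using assms
proof (induction xs arbitrary: ys)
  case Nil
  then show ?case by simp
next
  case (Cons x xs)
  obtain i l where x: "x = (i, l)" by fastforce
  obtain y zs where ys: "ys = y # zs" "fst y = \<sigma> i" "map fst zs = map \<sigma> (map fst xs)"
    using Cons.prems(1) x by (cases ys) auto
  \<comment> \<open>Both heads are the first entries of corresponding fibres, so they agree in the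
    second component too.\<close>
  have "map snd (filter (\<lambda>p. fst p = \<sigma> i) ys) = map snd (filter (\<lambda>p. fst p = i) (x # xs))"
    using Cons.prems(3) x by force
  then have y: "y = (\<sigma> i, l)"
    using ys x by (cases y) auto
  have "zs = map (map_prod \<sigma> id) xs"
  proof (rule Cons.IH[OF ys(3)])
    show "inj_on \<sigma> (fst ` set xs)"
      using Cons.prems(2) by (auto intro: inj_on_subset)
    fix j assume j: "j \<in> fst ` set xs"
    have eq: "map snd (filter (\<lambda>p. fst p = \<sigma> j) ys) = map snd (filter (\<lambda>p. fst p = j) (x # xs))"
      by (rule Cons.prems(3)) (use j in auto)
    \<comment> \<open>Injectivity of \<open>\<sigma>\<close> ensures that passing to the tails
      removes an entry from both fibres or from neither.\<close>
    have "\<sigma> j = \<sigma> i \<longleftrightarrow> j = i"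
      using Cons.prems(2) j x by (auto simp: inj_on_def)
    then show "map snd (filter (\<lambda>p. fst p = \<sigma> j) zs) = map snd (filter (\<lambda>p. fst p = j) xs)"
      using eq ys(1) x y by (auto split: if_splits)
  qed
  then show ?case
    using ys(1) x y by (simp add: id_def)
qed

text \<open>Since \<open>f\<close> is sorted along the list and has no ties, comparing
  \<open>f\<close>-values amounts to comparing positions, and these control the order of the
  \<open>g\<close>-values.\<close>

lemma sorted_maps_le:
  assumes "sorted (map f xs)" "sorted (map g xs)" "inj_on f (set xs)"
    and "a \<in> set xs" "b \<in> set xs" "f a \<le> f b"
  shows "g a \<le> g b"
proof -
  obtain r s where rs: "r < length xs" "xs ! r = a" "s < length xs" "xs ! s = b"
    using assms(4,5) by (auto simp: in_set_conv_nth)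
  show ?thesis
  proof (cases "r \<le> s")
    case True
    then show ?thesis
      using sorted_nth_mono[OF assms(2), of r s] rs by simp
  next
    case False
    then have "f b \<le> f a"
      using sorted_nth_mono[OF assms(1), of s r] rs by simp
    then have "a = b"
      using assms(3-6) by (auto dest: inj_onD)
    then show ?thesis by simp
  qed
qed

text \<open>A discrete intermediate value argument, used to locate an endpoint of a bar in a gap of
  the grid of the containing bar.\<close>

lemma between_consecutive:
  fixes g :: "nat \<Rightarrow> 'a::linorder"
  assumes "g 0 \<le> x" "x \<le> g N" "0 < N"
  obtains l where "l < N" "g l \<le> x" "x \<le> g (Suc l)"
  using assms
proof (induction N arbitrary: thesis)
  case (Suc N)
  show ?case
  proof (cases "N = 0 \<or> g N \<le> x")
    case True
    then show ?thesis using Suc.prems(1)[of N] Suc.prems(2,3) by auto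
  next
    case False
    then show ?thesis using Suc by (metis less_SucI linear not_gr_zero)
  qed
qed simp

lemma filter_fst_product:
  assumes "distinct xs" "i \<in> set xs"
  shows "filter (\<lambda>p. fst p = i) (List.product xs ys) = map (Pair i) ys"
  using assms
proof (induction xs)
  case (Cons x xs)
  have "filter (\<lambda>p. fst p = i) (List.product xs ys) = []" if "i \<notin> set xs"
    using that by (auto simp: filter_empty_conv)
  moreover have "filter (\<lambda>p. fst p = i) (map (Pair x) ys) = (if x = i then map (Pair i) ys else [])"
    by (induction ys) auto
  ultimately show ?case using Cons by auto
qed simp

section \<open>Grid points and labelings\<close>

lemma grid_point_0 [simp]: "grid_point k x 0 = fst x"
  by (simp add: grid_point_def)

lemma grid_point_last [simp]: "grid_point k x (2 ^ k) = snd x"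
  by (simp add: grid_point_def)

lemma grid_point_Suc: "grid_point k x (Suc l) = grid_point k x l + (snd x - fst x) / 2 ^ k"
  by (simp add: grid_point_def distrib_right add_divide_distrib)

lemma grid_point_mono:
  assumes "fst x \<le> snd x" "l \<le> m"
  shows "grid_point k x l \<le> grid_point k x m"
  using assms unfolding grid_point_def by (intro add_left_mono mult_right_mono) auto

lemma grid_point_affine:
  "grid_point k (a * fst x + c, a * snd x + c) l = a * grid_point k x l + c"
  by (simp add: grid_point_def algebra_simps add_divide_distrib diff_divide_distrib)

lemma labeling_set_mset:
  assumes "labeling B v"
  shows "set_mset B = v ` {1..size B}"
proof -
  have "set_mset (image_mset v (mset_set {1..size B})) = v ` {1..size B}" by simp
  then show ?thesis using assms by (simp only: labeling_def)
qed

lemma labeling_permute: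
  assumes "labeling B v" "\<sigma> permutes {1..size B}"
  shows "labeling B (v \<circ> \<sigma>)"
proof -
  have "image_mset \<sigma> (mset_set {1..size B}) = mset_set {1..size B}"
    using image_mset_mset_set[OF permutes_inj_on[OF assms(2)]] permutes_image[OF assms(2)] by simp
  then show ?thesis
    using assms(1) by (simp add: labeling_def image_mset.compositionality[symmetric])
qed

lemma k_strict_inj_on:
  assumes "barcode B" "k_strict k B" "labeling B v"
  shows "inj_on (\<lambda>(i, l). grid_point k (v i) l) ({1..size B} \<times> {0..2 ^ k})"
proof (rule inj_onI, clarify)
  fix i l j m
  assume *: "i \<in> {1..size B}" "j \<in> {1..size B}" "l \<in> {0..2 ^ k}" "m \<in> {0..2 ^ k}"
    "grid_point k (v i) l = grid_point k (v j) m"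
  then have "i = j"
    using k_strict_labeling[OF assms(2,3), of i j] by blast
  then show "i = j \<and> l = m"
    using * grid_point_inj[OF labeling_bar[OF assms(1,3)]] by blast
qed

text \<open>Filtering commutes with sorting, and the grid points of a single bar of positive length
  are already listed in increasing order. Hence the r-th occurrence of a letter in the word always
  stands for the r-th grid point of its bar.\<close>

lemma filter_fst_sorted_grid:
  assumes "\<And>i. i \<in> {1..n} \<Longrightarrow> fst (v i) < snd (v i)" "i \<in> {1..n}"
  shows "filter (\<lambda>p. fst p = i) (sort_key (\<lambda>(i, l). grid_point k (v i) l)
      (List.product [1..<Suc n] [0..<Suc m])) = map (Pair i) [0..<Suc m]"
proof -
  have "sorted (map (\<lambda>(i, l). grid_point k (v i) l) (map (Pair i) [0..<Suc m]))"
    using grid_point_mono[OF less_imp_le[OF assms(1)[OF assms(2)]]]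
    by (auto simp: sorted_iff_nth_mono simp del: upt_Suc)
  moreover have "filter (\<lambda>p. fst p = i) (List.product [1..<Suc n] [0..<Suc m])
      = map (Pair i) [0..<Suc m]"
    using assms(2) by (intro filter_fst_product) auto
  ultimately show ?thesis
    by (metis filter_sort sort_key_id_if_sorted)
qed

section \<open>From equal word classes to equal orders\<close>

text \<open>The words of two arbitrary labelings differ by a permutation \<open>\<sigma>\<close> of
  the letters; composing the labeling of \<open>B'\<close> with \<open>\<sigma>\<close> absorbs it.
  One and the same list of index pairs then sorts the grid points of both barcodes.\<close>

lemma word_class_eq_grid_order:
  assumes B: "barcode B" "k_strict k B" and B': "barcode B'"
    and size: "size B' = size B"
    and wc: "word_class k B = word_class k B'"
  obtains v w where "labeling B v" "labeling B' w"
    and "\<And>i j l m. i \<in> {1..size B} \<Longrightarrow> j \<in> {1..size B} \<Longrightarrow> l \<le> 2 ^ k \<Longrightarrow> m \<le> 2 ^ k \<Longrightarrow>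
      grid_point k (v i) l \<le> grid_point k (v j) m \<Longrightarrow>
      grid_point k (w i) l \<le> grid_point k (w j) m"
proof -
  let ?n = "size B"
  define v where "v = (SOME v. labeling B v)"
  define w where "w = (SOME w. labeling B' w)"
  have v: "labeling B v" and w: "labeling B' w"
    unfolding v_def w_def by (rule someI_ex[OF labeling_exists])+
  have "(bar_word k ?n v, bar_word k ?n w) \<in> relabel_rel (2 ^ k + 1) ?n"
    using wc eq_equiv_class[OF _ equiv_relabel_rel bar_word_in_multiperms] size
    unfolding word_class_def v_def w_def by simp
  then obtain \<sigma> where \<sigma>: "\<sigma> permutes {1..?n}" "bar_word k ?n w = map \<sigma> (bar_word k ?n v)"
    by (auto simp: relabel_rel_def)
  define key where "key = (\<lambda>u :: nat \<Rightarrow> bar. \<lambda>(i, l). grid_point k (u i) l)"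
  define P where "P = List.product [1..<Suc ?n] [0..<Suc (2 ^ k)]"
  define S where "S = sort_key (key v) P"
  have setS: "set S = {1..?n} \<times> {0..2 ^ k}"
    by (auto simp: S_def P_def)
  have fibre: "map snd (filter (\<lambda>p. fst p = i) (sort_key (key u) P)) = [0..<Suc (2 ^ k)]"
    if "i \<in> {1..?n}" "\<And>i. i \<in> {1..?n} \<Longrightarrow> fst (u i) < snd (u i)" for u i
    using filter_fst_sorted_grid[OF that(2,1)]
    by (simp add: key_def P_def comp_def del: upt_Suc)
  \<comment> \<open>The words give the agreement of first components only; the second components
    follow because each fibre reads 0, ..., 2^k in both lists.\<close>
  have "sort_key (key w) P = map (map_prod \<sigma> id) S"
  proof (rule map_prod_eq_by_fibres)
    show "map fst (sort_key (key w) P) = map \<sigma> (map fst S)"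
      using \<sigma>(2) by (simp only: bar_word_def S_def P_def key_def)
    show "inj_on \<sigma> (fst ` set S)"
      using permutes_inj_on[OF \<sigma>(1)] .
    fix i assume "i \<in> fst ` set S"
    then have i: "i \<in> {1..?n}" "\<sigma> i \<in> {1..?n}"
      using setS permutes_in_image[OF \<sigma>(1)] by auto
    show "map snd (filter (\<lambda>p. fst p = \<sigma> i) (sort_key (key w) P))
        = map snd (filter (\<lambda>p. fst p = i) S)"
      using fibre[OF i(1), of v] fibre[OF i(2), of w] labeling_bar[OF B(1) v]
        labeling_bar[OF B' w] size by (simp add: S_def)
  qed
  then have "sorted (map (key w) (map (map_prod \<sigma> id) S))"
    by (metis sorted_sort_key)
  \<comment> \<open>Evaluating \<open>key w\<close> after relabeling by \<open>\<sigma>\<close> is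
    evaluating \<open>key (w \<circ> \<sigma>)\<close> before it, so \<open>S\<close> itself is
    sorted for both barcodes.\<close>
  then have sorted_w: "sorted (map (key (w \<circ> \<sigma>)) S)"
    by (simp add: key_def comp_def case_prod_unfold)
  have "grid_point k ((w \<circ> \<sigma>) i) l \<le> grid_point k ((w \<circ> \<sigma>) j) m"
    if "i \<in> {1..?n}" "j \<in> {1..?n}" "l \<le> 2 ^ k" "m \<le> 2 ^ k"
      "grid_point k (v i) l \<le> grid_point k (v j) m" for i j l m
  proof -
    have "key (w \<circ> \<sigma>) (i, l) \<le> key (w \<circ> \<sigma>) (j, m)"
    proof (rule sorted_maps_le[OF _ sorted_w])
      show "sorted (map (key v) S)" by (simp add: S_def)
      show "inj_on (key v) (set S)"
        unfolding setS key_def by (rule k_strict_inj_on[OF B v])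
    qed (use that setS in \<open>auto simp: key_def\<close>)
    then show ?thesis by (simp add: key_def)
  qed
  moreover have "labeling B' (w \<circ> \<sigma>)"
    using labeling_permute[OF w] \<sigma>(1) size by simp
  ultimately show thesis
    using that v by blast
qed

text \<open>Containment only compares left endpoints with each other and right endpoints with each
  other. These are the grid points with index 0 and 2^k, so their order transfers.\<close>

lemma contains_all_transfer:
  assumes "barcode B" "k_strict k B" "barcode B'" "size B' = size B"
    and "word_class k B = word_class k B'" and "contains_all x B"
  shows "\<exists>y. contains_all y B'"
proof -
  obtain v w where v: "labeling B v" and w: "labeling B' w"
    and order: "\<And>i j l m. i \<in> {1..size B} \<Longrightarrow> j \<in> {1..size B} \<Longrightarrow> l \<le> 2 ^ k \<Longrightarrow> m \<le> 2 ^ k \<Longrightarrow>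
      grid_point k (v i) l \<le> grid_point k (v j) m \<Longrightarrow>
      grid_point k (w i) l \<le> grid_point k (w j) m"
    using word_class_eq_grid_order[OF assms(1-5)] by metis
  obtain i where i: "i \<in> {1..size B}" "x = v i"
    using assms(6) labeling_set_mset[OF v] by (auto simp: contains_all_def)
  have "fst (w i) \<le> fst (w j) \<and> snd (w j) \<le> snd (w i)" if j: "j \<in> {1..size B}" for j
  proof -
    have "fst (v i) \<le> fst (v j)" "snd (v j) \<le> snd (v i)"
      using assms(6) i j labeling_set_mset[OF v] by (auto simp: contains_all_def)
    then show ?thesis
      using order[OF i(1) j, of 0 0] order[OF j i(1), of "2 ^ k" "2 ^ k"] by simp
  qed
  then have "contains_all (w i) B'"
    using i(1) labeling_set_mset[OF w] assms(4) by (auto simp: contains_all_def)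
  then show ?thesis ..
qed

section \<open>Bounding the distances by one matching\<close>

lemma bottleneck_dist_le:
  assumes "perfect_matching B B' \<gamma>" "0 \<le> c" "\<And>x y. (x, y) \<in># \<gamma> \<Longrightarrow> infnorm (x - y) \<le> c"
  shows "bottleneck_dist B B' \<le> c"
proof -
  have "bottleneck_dist B B' \<le> Max (insert 0 ((\<lambda>(x, y). infnorm (x - y)) ` set_mset \<gamma>))"
    unfolding bottleneck_dist_def
    \<comment> \<open>A real infimum lies below each member only if the set is bounded below; the
      inserted 0 makes every maximum nonnegative.\<close>
    by (rule cINF_lower) (use assms(1) in \<open>auto intro!: bdd_belowI2[of _ 0]\<close>)
  also have "\<dots> \<le> c"
    using assms(2,3) by auto
  finally show ?thesis .
qed

lemma wasserstein_dist_le: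
  assumes "perfect_matching B B' \<gamma>"
  shows "wasserstein_dist q B B' \<le> (\<Sum>(x, y)\<in>#\<gamma>. infnorm (x - y) powr q) powr (1 / q)"
  unfolding wasserstein_dist_def
  by (rule cINF_lower) (use assms in \<open>auto intro!: bdd_belowI2[of _ 0]\<close>)

lemma perfect_matching_labelings:
  assumes "labeling B v" "labeling B' w" "size B' = size B"
  shows "perfect_matching B (image_mset f B')
    (image_mset (\<lambda>i. (v i, f (w i))) (mset_set {1..size B}))"
proof -
  have "image_mset f (image_mset w (mset_set {1..size B})) = image_mset f B'"
    using assms(2,3) by (simp add: labeling_def)
  then show ?thesis
    using assms(1) unfolding perfect_matching_def
    \<comment> \<open>All bars are paired with bars: the two parts of the matching that involve the
      diagonal are empty.\<close>
    by (intro exI[of _ "image_mset (\<lambda>i. (v i, f (w i))) (mset_set {1..size B})"]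
        exI[of _ "{#}"]) (auto simp: labeling_def image_mset.compositionality comp_def)
qed

section \<open>Aligning the containing bars\<close>

theorem theorem4:
  fixes k n :: nat and q :: real and B B' :: "(real \<times> real) multiset"
  assumes "q \<ge> 1"
    and "barcode B" and "size B = n" and "k_strict k B"
    and "barcode B'" and "size B' = n" and "k_strict k B'"
    and "word_class k B = word_class k B'"
  shows "((\<exists>x. contains_all x B) \<longleftrightarrow> (\<exists>x. contains_all x B')) \<and>
    (\<forall>bs ds. contains_all (bs, ds) B \<longrightarrow>
      (\<exists>\<alpha>>0. \<exists>\<delta>.
        bottleneck_dist B (rescale \<alpha> \<delta> B') \<le> \<bar>ds - bs\<bar> / 2 ^ k \<and>
        wasserstein_dist q B (rescale \<alpha> \<delta> B') \<le> (real n - 1) powr (1 / q) * (\<bar>ds - bs\<bar> / 2 ^ k)))"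
proof (intro conjI allI impI)
  \<comment> \<open>The two directions use the strictness of \<open>B\<close> and of
    \<open>B'\<close> respectively.\<close>
  show "(\<exists>x. contains_all x B) \<longleftrightarrow> (\<exists>x. contains_all x B')"
    using contains_all_transfer[of B k B'] contains_all_transfer[of B' k B] assms by metis
next
  fix bs ds assume contains: "contains_all (bs, ds) B"
  obtain v w where v: "labeling B v" and w: "labeling B' w"
    and order: "\<And>i j l m. i \<in> {1..n} \<Longrightarrow> j \<in> {1..n} \<Longrightarrow> l \<le> 2 ^ k \<Longrightarrow> m \<le> 2 ^ k \<Longrightarrow>
      grid_point k (v i) l \<le> grid_point k (v j) m \<Longrightarrow>
      grid_point k (w i) l \<le> grid_point k (w j) m"
    using word_class_eq_grid_order[of B k B'] assms by metis
  obtain s where s: "s \<in> {1..n}" "v s = (bs, ds)"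
    using contains labeling_set_mset[OF v] assms(3) by (auto simp: contains_all_def)
  have vs: "bs < ds" and ws: "fst (w s) < snd (w s)"
    using labeling_bar[OF assms(2) v, of s] labeling_bar[OF assms(5) w, of s] s assms(3,6) by auto
  define \<alpha> where "\<alpha> = (ds - bs) / (snd (w s) - fst (w s))"
  define \<delta> where "\<delta> = bs - \<alpha> * fst (w s)"
  define T where "T = (\<lambda>x :: bar. (\<alpha> * fst x + \<delta>, \<alpha> * snd x + \<delta>))"
  define c where "c = \<bar>ds - bs\<bar> / 2 ^ k"
  have \<alpha>: "\<alpha> > 0"
    using vs ws by (simp add: \<alpha>_def)
  have "\<alpha> * (snd (w s) - fst (w s)) = ds - bs"
    using ws by (simp add: \<alpha>_def)
  then have Ts: "T (w s) = v s"
    by (simp add: T_def \<delta>_def s(2) algebra_simps)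
  have gT: "grid_point k (T x) l = \<alpha> * grid_point k x l + \<delta>" for x l
    unfolding T_def by (rule grid_point_affine)
  have orderT: "grid_point k (T (w i)) l \<le> grid_point k (T (w j)) m"
    if "i \<in> {1..n}" "j \<in> {1..n}" "l \<le> 2 ^ k" "m \<le> 2 ^ k"
      "grid_point k (v i) l \<le> grid_point k (v j) m" for i j l m
    using order[OF that] \<alpha> by (simp add: gT)
  \<comment> \<open>The indices 0 and 2^k give the two endpoints of a bar, that is, the two
    coordinates entering \<open>infnorm\<close>.\<close>
  have close: "\<bar>grid_point k (v i) l - grid_point k (T (w i)) l\<bar> \<le> c"
    if i: "i \<in> {1..n}" and l: "l \<in> {0, 2 ^ k}" for i l
  proof -
    have vi: "fst (v i) < snd (v i)"
      using labeling_bar[OF assms(2) v] i assms(3) by simp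
    have "bs \<le> fst (v i)" "snd (v i) \<le> ds"
      using contains i assms(3) labeling_set_mset[OF v] by (auto simp: contains_all_def)
    then have "grid_point k (v s) 0 \<le> grid_point k (v i) l"
      "grid_point k (v i) l \<le> grid_point k (v s) (2 ^ k)"
      using vi l s(2) by auto
    then obtain m where m: "m < 2 ^ k" "grid_point k (v s) m \<le> grid_point k (v i) l"
      "grid_point k (v i) l \<le> grid_point k (v s) (Suc m)"
      using between_consecutive[of "grid_point k (v s)"] by (metis zero_less_numeral zero_less_power)
    \<comment> \<open>\<open>orderT\<close> turns comparisons with the grid of \<open>v s\<close>
      into comparisons with the grid of \<open>T (w s)\<close>, which is the same grid by
      \<open>Ts\<close>. The bound \<open>m < 2 ^ k\<close> keeps \<open>Suc m\<close> a legal grid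
      index.\<close>
    have "grid_point k (v s) m \<le> grid_point k (T (w i)) l"
      "grid_point k (T (w i)) l \<le> grid_point k (v s) (Suc m)"
      using orderT[of s i m l] orderT[of i s l "Suc m"] m s(1) i l Ts by auto
    moreover have "grid_point k (v s) (Suc m) = grid_point k (v s) m + c"
      using vs s(2) by (simp add: grid_point_Suc c_def)
    ultimately show ?thesis using m by linarith
  qed
  have norm: "infnorm (v i - T (w i)) \<le> c" if "i \<in> {1..n}" for i
    using close[OF that, of 0] close[OF that, of "2 ^ k"]
    by (simp add: infnorm_pair minus_prod_def)
  have c0: "c \<ge> 0" by (simp add: c_def)
  define \<gamma> where "\<gamma> = image_mset (\<lambda>i. (v i, T (w i))) (mset_set {1..n})"
  have "rescale \<alpha> \<delta> B' = image_mset T B'"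
    by (simp add: rescale_def T_def case_prod_unfold)
  then have pm: "perfect_matching B (rescale \<alpha> \<delta> B') \<gamma>"
    using perfect_matching_labelings[OF v w, of T] assms(3,6) by (simp add: \<gamma>_def)
  have "bottleneck_dist B (rescale \<alpha> \<delta> B') \<le> c"
    by (rule bottleneck_dist_le[OF pm c0]) (use norm in \<open>auto simp: \<gamma>_def\<close>)
  moreover have "wasserstein_dist q B (rescale \<alpha> \<delta> B') \<le> (real n - 1) powr (1 / q) * c"
  proof -
    have sum_eq: "(\<Sum>(x, y)\<in>#\<gamma>. infnorm (x - y) powr q) = (\<Sum>i\<in>{1..n}. infnorm (v i - T (w i)) powr q)"
      by (simp add: \<gamma>_def image_mset.compositionality comp_def sum_unfold_sum_mset)
    \<comment> \<open>The term at \<open>s\<close> vanishes because \<open>T (w s) = v s\<close> and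
      \<open>0 powr q = 0\<close>; this is where n - 1 replaces n.\<close>
    also have "\<dots> = (\<Sum>i\<in>{1..n} - {s}. infnorm (v i - T (w i)) powr q)"
      using s(1) Ts by (subst sum.remove[of _ s]) (auto simp: infnorm_0)
    also have "\<dots> \<le> (\<Sum>i\<in>{1..n} - {s}. c powr q)"
      using norm assms(1) by (intro sum_mono powr_mono2) (auto simp: infnorm_pos_le)
    also have "\<dots> = (real n - 1) * c powr q"
      using s(1) by (simp add: of_nat_diff)
    finally have sum_le: "(\<Sum>(x, y)\<in>#\<gamma>. infnorm (x - y) powr q) \<le> (real n - 1) * c powr q" .
    have "wasserstein_dist q B (rescale \<alpha> \<delta> B')
        \<le> (\<Sum>(x, y)\<in>#\<gamma>. infnorm (x - y) powr q) powr (1 / q)"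
      by (rule wasserstein_dist_le[OF pm])
    also have "\<dots> \<le> ((real n - 1) * c powr q) powr (1 / q)"
    proof (rule powr_mono2)
      show "0 \<le> (\<Sum>(x, y)\<in>#\<gamma>. infnorm (x - y) powr q)"
        unfolding sum_eq by (simp add: sum_nonneg)
    qed (use sum_le assms(1) in auto)
    \<comment> \<open>The index \<open>s\<close> witnesses n \<ge> 1, so both factors are
      nonnegative and the power distributes. For n = 1 both sides are 0, as
      \<open>0 powr (1 / q) = 0\<close>.\<close>
    also have "\<dots> = (real n - 1) powr (1 / q) * c"
      using assms(1) c0 s(1) by (simp add: powr_mult powr_powr)
    finally show ?thesis .
  qed
  ultimately show "\<exists>\<alpha>>0. \<exists>\<delta>.
      bottleneck_dist B (rescale \<alpha> \<delta> B') \<le> \<bar>ds - bs\<bar> / 2 ^ k \<and>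
      wasserstein_dist q B (rescale \<alpha> \<delta> B') \<le> (real n - 1) powr (1 / q) * (\<bar>ds - bs\<bar> / 2 ^ k)"
    using \<alpha> unfolding c_def by blast
qed

end
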